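(* Let $\mathcal{C}$ be an $[n,K,d_{\min},\alpha,\kappa]$ vector code over $\mathbb{F}_q$ with $(r,\delta)$ information locality, $\delta\ge2$. Let $\{\mathcal{C}_i\}_{i\in\mathcal{L}}$ be the local punctured codes, of length at most $n_L=r+\delta-1$ and minimum distance at least $\delta$, with supports $S_i$, $i\in\mathcal{L}$, and set $S=\cup_{i\in\mathcal{L}}S_i$. Let $\mathcal{I}_0$ be a minimum cardinality information set for $\mathcal{C}|_S$, so that $|\mathcal{I}_0|$ is the quasi-dimension of $\mathcal{C}|_S$. Then $$\begin{aligned} d_{\min}&\le n-|\mathcal{I}_0|+1-\left(\left\lceil\frac{|\mathcal{I}_0|}{r}\right\rceil-1\right)(\delta-1)\\ &\le n-\kappa+1-\left(\left\lceil\frac{\kappa}{r}\right\rceil-1\right)(\delta-1)\\ &\le n-\left\lceil\frac{K}{\alpha}\right\rceil+1-\left(\left\lceil\frac{K}{r\alpha}\right\rceil-1\right)(\delta-1). \end{aligned}$$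
   Context: An $\mathbb{F}_q$-linear vector code $\mathcal{C}$ of block length $n$ with vector-size parameter $\alpha\ge1$ is an $\mathbb{F}_q$-linear subspace of $(\mathbb{F}_q^\alpha)^n$. Its scalar dimension is $K=\dim_{\mathbb{F}_q}\mathcal{C}$. Expanding each vector symbol into $\alpha$ scalars gives a scalar code of length $n\alpha$ with $K\times n\alpha$ generator matrix $G$; the columns $(i-1)\alpha+1,\dots,i\alpha$ form the $i$-th thick column of $G$. Standing assumption: the $\alpha$ columns in each thick column are linearly independent. For $S\subseteq[n]$, $G|_S$ is the restriction of $G$ to the thick columns indexed by $S$, and $\mathcal{C}|_S$ is the code punctured to (restricted to) $S$. The minimum distance $d_{\min}$ is the minimum Hamming weight, counted in vector symbols, of a nonzero codeword. An information set of $\mathcal{C}$ is a set $\mathcal{I}\subseteq[n]$ with $\mathrm{rank}(G|_{\mathcal{I}})=K$ such that no proper subset has this property; the quasi-dimension $\kappa$ of $\mathcal{C}$ is the minimum cardinality of an information set. These notions apply likewise to punctured codes $\mathcal{C}|_S$ (information sets $\mathcal{I}\subseteq S$ with $\mathrm{rank}(G|_{\mathcal{I}})=\mathrm{rank}(G|_S)$). An $[n,K,d_{\min},\alpha,\kappa]$ code is a vector code with these parameters. $\mathcal{C}$ has $(r,\delta)$ information locality if there are punctured codes $\mathcal{C}_i=\mathcal{C}|_{S_i}$, $i\in\mathcal{L}$ (the local codes), with $|S_i|\le r+\delta-1$ and $d_{\min}(\mathcal{C}_i)\ge\delta$ for all $i\in\mathcal{L}$, and $\mathrm{Rank}(G|_{\cup_{i\in\mathcal{L}}S_i})=K$.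 *)

theory Defs
  imports "HOL-Analysis.Analysis"
begin

text \<open>
  A word in \<open>(F\<^sup>\<alpha>)\<^sup>n\<close> has type \<open>'a^'m^'n\<close>: \<open>'n\<close> indexes the \<open>n\<close> vector symbols and \<open>'m\<close> the
  \<open>\<alpha>\<close> scalars inside a symbol. The library has no \<open>F\<close>-module structure on nested vectors for a
  general field \<open>F\<close>, hence the following interpretation.
\<close>

definition word_scale :: "'a::field \<Rightarrow> 'a^'m^'n \<Rightarrow> 'a^'m^'n" where
  "word_scale a c = (\<chi> i. a *s (c $ i))"

global_interpretation words: vector_space "word_scale :: 'a::field \<Rightarrow> 'a^'m^'n \<Rightarrow> 'a^'m^'n"
  by unfold_locales (simp_all add: word_scale_def vec_eq_iff algebra_simps)

definition hamming_weight :: "'a::zero^'m^'n \<Rightarrow> nat" where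
  "hamming_weight c = card {i. c $ i \<noteq> 0}"

text \<open>The zero code has no nonzero codeword, and its minimum distance is \<open>\<infinity>\<close>.\<close>

definition min_dist :: "('a::zero^'m^'n) set \<Rightarrow> enat" where
  "min_dist C = (INF c\<in>C - {0}. enat (hamming_weight c))"

text \<open>
  Deleted coordinates are set to 0 instead of being removed, here and in \<open>thick_restrict\<close>. This is
  an isomorphism onto the punctured code that preserves weights, and it does not change the rank
  of a matrix. The length of the code punctured to \<open>T\<close> is \<open>card T\<close>, not \<open>CARD('n)\<close>.
\<close>

definition puncture :: "'n set \<Rightarrow> ('a::zero^'m^'n) set \<Rightarrow> ('a^'m^'n) set" where
  "puncture T C = (\<lambda>c. \<chi> i. if i \<in> T then c $ i else 0) ` C"

text \<open>
  The scalar positions of the expanded code are the pairs \<open>(i, j)\<close>, where \<open>j\<close> is the position inside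
  the symbol \<open>i\<close>. The columns \<open>(i, j)\<close> of a generator matrix with \<open>i\<close> fixed form its \<open>i\<close>-th thick
  column.
\<close>

definition expand :: "'a^'m^'n \<Rightarrow> 'a^('n::finite \<times> 'm::finite)" where
  "expand c = (\<chi> p. c $ fst p $ snd p)"

definition generator_matrix :: "'a::field^('n::finite \<times> 'm::finite)^'k \<Rightarrow> ('a^'m^'n) set \<Rightarrow> bool" where
  "generator_matrix G C \<longleftrightarrow>
     inj (\<lambda>k. row k G) \<and> vec.independent (rows G) \<and> vec.span (rows G) = expand ` C"

definition thick_columns_independent :: "'a::field^('n::finite \<times> 'm::finite)^'k \<Rightarrow> bool" where
  "thick_columns_independent G \<longleftrightarrow>
     (\<forall>i. inj (\<lambda>j. column (i, j) G) \<and> vec.independent (range (\<lambda>j. column (i, j) G)))"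

definition thick_restrict :: "'a::zero^('n::finite \<times> 'm::finite)^'k \<Rightarrow> 'n set \<Rightarrow> 'a^('n \<times> 'm)^'k" where
  "thick_restrict G T = (\<chi> k p. if fst p \<in> T then G $ k $ p else 0)"

text \<open>
  Information sets and quasi-dimension of the code punctured to \<open>T\<close>, where \<open>G\<close> generates the full
  code. The full code is the case \<open>T = UNIV\<close>, with \<open>rank (thick_restrict G UNIV) = rank G = K\<close>.
\<close>

definition information_set :: "'a::field^('n::finite \<times> 'm::finite)^'k \<Rightarrow> 'n set \<Rightarrow> 'n set \<Rightarrow> bool" where
  "information_set G T I \<longleftrightarrow>
     I \<subseteq> T \<and> rank (thick_restrict G I) = rank (thick_restrict G T) \<and>
     (\<forall>J. J \<subset> I \<longrightarrow> rank (thick_restrict G J) \<noteq> rank (thick_restrict G T))"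

definition quasi_dimension :: "'a::field^('n::finite \<times> 'm::finite)^'k \<Rightarrow> 'n set \<Rightarrow> nat" where
  "quasi_dimension G T = Min (card ` {I. information_set G T I})"

text \<open>
  The supports \<open>S i\<close>, \<open>i \<in> L\<close>, define local codes that witness \<open>(r, \<delta>)\<close> information locality of the
  code \<open>C\<close> with generator matrix \<open>G\<close>; the rank of \<open>G\<close> is the scalar dimension of \<open>C\<close>.
\<close>

definition local_codes ::
    "'a::field^('n::finite \<times> 'm::finite)^'k \<Rightarrow> ('a^'m^'n) set \<Rightarrow> nat \<Rightarrow> nat \<Rightarrow> 'l set \<Rightarrow> ('l \<Rightarrow> 'n set) \<Rightarrow> bool" where
  "local_codes G C r \<delta> L S \<longleftrightarrow>
     (\<forall>i\<in>L. card (S i) \<le> r + \<delta> - 1 \<and> enat \<delta> \<le> min_dist (puncture (S i) C)) \<and>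
     rank (thick_restrict G (\<Union>i\<in>L. S i)) = words.dim C"

end

theory Submission
  imports Defs
begin

text \<open>
  A set \<open>T\<close> of positions has full rank iff no nonzero codeword vanishes on it, so \<open>d\<^sub>m\<^sub>i\<^sub>n \<le> n - |T|\<close>
  whenever \<open>T\<close> does not have full rank. A large such \<open>T\<close> is found greedily: join local supports
  \<open>S\<^sub>i\<close> that are not yet determined by the positions collected so far. Every such support has at
  least \<open>\<delta>\<close> new positions; any \<open>\<delta> - 1\<close> of them are redundant because \<open>d\<^sub>m\<^sub>i\<^sub>n(C\<^sub>i) \<ge> \<delta>\<close>, and the
  other ones, at most \<open>r\<close>, are kept. As long as the kept positions number fewer than \<open>|I\<^sub>0|\<close> they cannot have full rank, so
  the last join that can be performed leaves at least \<open>\<lceil>|I\<^sub>0| / r\<rceil> - 1\<close> blocks of \<open>\<delta> - 1\<close> redundant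
  positions, and it can be truncated just before full rank is reached.
\<close>

section \<open>Positions determining other positions, and the minimum distance\<close>

text \<open>Differences of codewords are codewords, so for linear \<open>C\<close> the symbols on
  \<open>A\<close> fix those on \<open>T\<close>; equivalently, adding the thick columns of
  \<open>T\<close> to those of \<open>A\<close> does not raise the rank.\<close>

definition determines :: "('a::zero^'m^'n) set \<Rightarrow> 'n set \<Rightarrow> 'n set \<Rightarrow> bool" where
  "determines C A T \<longleftrightarrow> (\<forall>c\<in>C. (\<forall>i\<in>A. c $ i = 0) \<longrightarrow> (\<forall>i\<in>T. c $ i = 0))"

lemma determines_superset: "T \<subseteq> A \<Longrightarrow> determines C A T"
  by (auto simp: determines_def)

lemma determines_trans: "determines C A T \<Longrightarrow> determines C T U \<Longrightarrow> determines C A U"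
  by (simp add: determines_def)

lemma determines_mono: "determines C A T \<Longrightarrow> A \<subseteq> B \<Longrightarrow> determines C B T"
  by (meson determines_superset determines_trans)

lemma determines_Un:
  "determines C A T \<Longrightarrow> determines C B U \<Longrightarrow> determines C (A \<union> B) (T \<union> U)"
  unfolding determines_def by blast

lemma determines_UN:
  "(\<And>i. i \<in> L \<Longrightarrow> determines C A (S i)) \<Longrightarrow> determines C A (\<Union>i\<in>L. S i)"
  unfolding determines_def by blast

text \<open>A nonzero codeword vanishing on \<open>T\<close> is supported in \<open>- T\<close>,
  which bounds its weight.\<close>

lemma min_dist_le_if_not_determines:
  fixes C :: "('a::zero^'m^'n::finite) set"
  assumes "\<not> determines C T UNIV"
  shows "min_dist C \<le> enat (CARD('n) - card T)"
proof -
  obtain c i where c: "c \<in> C" "\<forall>i\<in>T. c $ i = 0" "c $ i \<noteq> 0"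
    using assms by (auto simp: determines_def)
  then have "c \<in> C - {0}" by auto
  then have "min_dist C \<le> enat (hamming_weight c)"
    unfolding min_dist_def by (rule INF_lower)
  moreover have "hamming_weight c \<le> card (- T)"
    unfolding hamming_weight_def using c by (intro card_mono) auto
  moreover have "card (- T) = CARD('n) - card T"
    by (simp add: Compl_eq_Diff_UNIV card_Diff_subset)
  ultimately show ?thesis
    by (metis enat_ord_simps(1) order_trans)
qed

text \<open>Erasure decoding: a codeword vanishing on \<open>T - D\<close> punctures to a word of
  weight at most \<open>card D < \<delta>\<close>, and such a word must be 0.\<close>

lemma determines_Diff_if_puncture_min_dist:
  fixes C :: "('a::zero^'m^'n::finite) set"
  assumes "enat \<delta> \<le> min_dist (puncture T C)" and "card D < \<delta>"
  shows "determines C (T - D) T"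
proof (rule ccontr)
  assume "\<not> determines C (T - D) T"
  then obtain c i where c: "c \<in> C" "\<forall>i\<in>T - D. c $ i = 0" "i \<in> T" "c $ i \<noteq> 0"
    by (auto simp: determines_def)
  define p where "p = (\<chi> i. if i \<in> T then c $ i else 0)"
  have "p $ i \<noteq> 0"
    using c by (simp add: p_def)
  then have "p \<noteq> 0" by auto
  then have "p \<in> puncture T C - {0}"
    using c(1) by (auto simp: puncture_def p_def)
  then have "min_dist (puncture T C) \<le> enat (hamming_weight p)"
    unfolding min_dist_def by (rule INF_lower)
  with assms(1) have "enat \<delta> \<le> enat (hamming_weight p)"
    by (rule order_trans)
  moreover have "hamming_weight p \<le> card D"
    unfolding hamming_weight_def using c(2) by (intro card_mono) (auto simp: p_def)
  ultimately show False
    using assms(2) by simp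
qed

section \<open>Greedy choice of local supports\<close>

text \<open>For r > 0 the last conclusion says that \<open>j\<close> is at least the ceiling of m/r
  minus 1, so the middle one makes \<open>T\<close> large enough for the first bound of the theorem,
  with \<open>m\<close> the size of \<open>I\<^sub>0\<close>.\<close>

lemma greedy_non_determining_set:
  fixes C :: "('a::zero^'m^'n::finite) set"
  assumes len: "\<And>i. i \<in> L \<Longrightarrow> card (S i) \<le> r + \<delta> - 1"
    and local: "\<And>i D. i \<in> L \<Longrightarrow> card D < \<delta> \<Longrightarrow> determines C (S i - D) (S i)"
    and full: "determines C (\<Union>i\<in>L. S i) UNIV"
    and nonzero: "\<not> determines C {} UNIV"
    and m: "\<And>A. A \<subseteq> (\<Union>i\<in>L. S i) \<Longrightarrow> determines C A UNIV \<Longrightarrow> m \<le> card A"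
    and \<delta>: "\<delta> \<ge> 2"
  obtains T j where "\<not> determines C T UNIV" and "m + j * (\<delta> - 1) \<le> card T + 1" and "m \<le> Suc j * r"
proof -
  \<comment> \<open>After \<open>j\<close> joins, \<open>T\<close> collects all positions and \<open>A\<close> the kept ones.\<close>
  define P where "P j T A \<longleftrightarrow> T \<subseteq> (\<Union>i\<in>L. S i) \<and> A \<subseteq> T \<and> determines C A T \<and>
    \<not> determines C T UNIV \<and> card T = card A + j * (\<delta> - 1) \<and> card A \<le> j * r" for j T A
  have "P 0 {} {}"
    using nonzero by (simp add: P_def determines_superset)
  \<comment> \<open>As \<delta> - 1 is at least 1, every join adds a redundant position. This bounds
    \<open>j\<close>, so there is a last join that stays short of full rank.\<close>
  moreover have "j \<le> CARD('n)" if P: "\<exists>T A. P j T A" for j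
  proof -
    obtain T A where "P j T A" using P by blast
    then have "j * (\<delta> - 1) \<le> card T" by (simp add: P_def)
    moreover have "j * 1 \<le> j * (\<delta> - 1)" using \<delta> by (intro mult_le_mono) auto
    moreover have "card T \<le> CARD('n)" by (intro card_mono) auto
    ultimately show ?thesis by linarith
  qed
  ultimately obtain j where "\<exists>T A. P j T A" and max: "\<And>k. \<exists>T A. P k T A \<Longrightarrow> k \<le> j"
    using Nat.ex_has_greatest_nat[of "\<lambda>j. \<exists>T A. P j T A" 0 "CARD('n)"] by blast
  then obtain T A where "P j T A" by blast
  then have T: "T \<subseteq> (\<Union>i\<in>L. S i)" "\<not> determines C T UNIV"
    and A: "A \<subseteq> T" "determines C A T" "card T = card A + j * (\<delta> - 1)" "card A \<le> j * r"
    by (auto simp: P_def)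
  obtain i where i: "i \<in> L" "\<not> determines C T (S i)"
    using T(2) full determines_UN determines_trans by metis
  let ?N = "S i - T"
  \<comment> \<open>With fewer than \<delta> new positions, those of \<open>S i\<close> inside
    \<open>T\<close> would already determine \<open>S i\<close>.\<close>
  have "\<delta> \<le> card ?N"
  proof (rule ccontr)
    assume "\<not> \<delta> \<le> card ?N"
    then have "determines C (S i - ?N) (S i)" using local i(1) by simp
    then show False using i(2) determines_mono by (metis Diff_Diff_Int inf_le2)
  qed
  \<comment> \<open>\<open>D\<close> takes \<delta> - 1 new positions as redundant; the kept rest
    \<open>B\<close> has at most \<open>r\<close> positions because of the length bound on
    \<open>S i\<close>.\<close>
  then obtain D where D: "D \<subseteq> ?N" "card D = \<delta> - 1"
    by (metis diff_le_self le_trans obtain_subset_with_card_n)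
  define B where "B = ?N - D"
  have N: "?N = B \<union> D" "B \<inter> D = {}" using D by (auto simp: B_def)
  have B: "B \<subseteq> S i" "B \<inter> T = {}" by (auto simp: B_def)
  have card_N: "card ?N = card B + (\<delta> - 1)"
    using N D by (simp add: card_Un_disjoint)
  moreover have "card ?N \<le> card (S i)" by (intro card_mono) auto
  ultimately have card_B: "card B \<le> r" using len[OF i(1)] \<delta> by linarith
  have "S i - D \<subseteq> T \<union> B" using N by auto
  then have "determines C (T \<union> B) (S i)"
    using local[OF i(1), of D] D(2) \<delta> by (auto intro: determines_mono)
  moreover have "determines C (A \<union> B) (T \<union> B)"
    using A(2) by (simp add: determines_Un determines_superset)
  ultimately have "determines C (A \<union> B) (S i)" by (rule determines_trans[rotated])
  then have det: "determines C (A \<union> B) (T \<union> S i)"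
    using determines_Un[OF A(2), of "A \<union> B" "S i"] by simp
  have card_AB: "card (A \<union> X) = card A + card X" if "X \<subseteq> B" for X
    using that A(1) B(2) by (intro card_Un_disjoint) auto
  have "card (T \<union> S i) = card T + card ?N"
    by (subst Un_Diff_cancel[symmetric], intro card_Un_disjoint) auto
  then have "card (T \<union> S i) = card (A \<union> B) + Suc j * (\<delta> - 1)" "card (A \<union> B) \<le> Suc j * r"
    using A(3,4) card_AB[of B] card_B card_N by auto
  moreover have "T \<union> S i \<subseteq> (\<Union>i\<in>L. S i)" "A \<union> B \<subseteq> T \<union> S i"
    using T(1) i(1) A(1) B(1) by auto
  ultimately have "P (Suc j) (T \<union> S i) (A \<union> B)" if "\<not> determines C (T \<union> S i) UNIV"
    using that det by (simp add: P_def)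
  \<comment> \<open>Only the incompleteness clause of \<open>P\<close> can fail at
    \<open>Suc j\<close>. By maximality of \<open>j\<close> it does, so this join reaches full
    rank.\<close>
  then have "determines C (T \<union> S i) UNIV"
    using max[of "Suc j"] by (meson not_less_eq_eq order_refl)
  then have AB: "determines C (A \<union> B) UNIV"
    using det determines_trans by blast
  \<comment> \<open>The last join is truncated to an inclusion-maximal part of \<open>B\<close> that
    stays short of full rank. Its block \<open>D\<close> is left out, so only the \<open>j\<close>
    earlier blocks count as redundant.\<close>
  define Q where "Q X \<longleftrightarrow> X \<subseteq> B \<and> \<not> determines C (A \<union> X) UNIV" for X
  have "Q {}" using A T(2) by (auto simp: Q_def dest: determines_mono)
  then have "finite (Collect Q)" "Collect Q \<noteq> {}" by auto
  then obtain X where X: "Q X" and X_max: "\<And>Y. Q Y \<Longrightarrow> X \<subseteq> Y \<Longrightarrow> X = Y"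
    using finite_has_maximal[of "Collect Q"] by auto
  then have "X \<noteq> B" using AB by (auto simp: Q_def)
  then obtain x where x: "x \<in> B" "x \<notin> X" using X by (auto simp: Q_def)
  then have "\<not> Q (insert x X)" using X_max[of "insert x X"] by auto
  then have AX: "determines C (A \<union> insert x X) UNIV" using x X by (auto simp: Q_def)
  have m_le: "m \<le> card A + card Y" if "Y \<subseteq> B" "determines C (A \<union> Y) UNIV" for Y
  proof -
    have "A \<union> Y \<subseteq> (\<Union>i\<in>L. S i)"
      using that(1) A(1) T(1) B(1) i(1) by blast
    from m[OF this that(2)] show ?thesis by (simp only: card_AB[OF that(1)])
  qed
  have "X \<subseteq> B" using X by (simp add: Q_def)
  show thesis
  proof (rule that)
    have "determines C (A \<union> X) (T \<union> X)"
      using A(2) by (rule determines_Un) (simp add: determines_superset)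
    then show "\<not> determines C (T \<union> X) UNIV"
      using X determines_trans unfolding Q_def by blast
    have "card (T \<union> X) = card T + card X"
      using \<open>X \<subseteq> B\<close> B(2) by (intro card_Un_disjoint) auto
    \<comment> \<open>The single position \<open>x\<close> that brings \<open>A \<union> X\<close>
      to full rank accounts for the + 1.\<close>
    moreover have "m \<le> card A + card (insert x X)"
      using m_le[OF _ AX] x(1) \<open>X \<subseteq> B\<close> by simp
    ultimately show "m + j * (\<delta> - 1) \<le> card (T \<union> X) + 1"
      using A(3) x(2) by simp
    \<comment> \<open>Here the whole last join is counted: at most j r positions in \<open>A\<close>
      and \<open>r\<close> in \<open>B\<close>.\<close>
    show "m \<le> Suc j * r"
      using m_le[OF order_refl AB] A(4) card_B by simp
  qed
qed

section \<open>Rank of restrictions to thick columns\<close>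

text \<open>\<open>thick_restrict\<close> acts on every row by this linear map, so the rank of a
  restriction is the dimension of the image of the row space.\<close>

definition mask :: "'n set \<Rightarrow> 'a::zero^('n::finite \<times> 'm::finite) \<Rightarrow> 'a^('n \<times> 'm)" where
  "mask T v = (\<chi> p. if fst p \<in> T then v $ p else 0)"

lemma linear_mask: "Vector_Spaces.linear (*s) (*s) (mask T :: 'a::field^('n::finite \<times> 'm::finite) \<Rightarrow> _)"
  by unfold_locales (auto simp: mask_def vec_eq_iff algebra_simps)

lemma rows_thick_restrict: "rows (thick_restrict G T) = mask T ` rows G"
  by (auto simp: rows_def row_def thick_restrict_def mask_def vec_eq_iff)

text \<open>The image of a basis of \<open>V\<close> spans the image of \<open>V\<close>. If no
  dimension is lost, it is independent and of the same size, so \<open>f\<close> is injective on the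
  span.\<close>

lemma dim_image_eq_iff_inj_on_span:
  fixes f :: "'a::field^'n \<Rightarrow> 'a^'n"
  assumes f: "Vector_Spaces.linear (*s) (*s) f"
  shows "vec.dim (f ` V) = vec.dim V \<longleftrightarrow> inj_on f (vec.span V)"
proof
  interpret f: Vector_Spaces.linear "(*s)" "(*s)" f by (fact f)
  assume eq: "vec.dim (f ` V) = vec.dim V"
  obtain B where B: "B \<subseteq> V" "vec.independent B" "V \<subseteq> vec.span B" "card B = vec.dim V"
    by (rule vec.basis_exists)
  have fin: "finite B" using B(2) by (rule vec.finiteI_independent)
  have sub: "f ` V \<subseteq> vec.span (f ` B)" using B(3) f.span_image by blast
  have "vec.dim V \<le> card (f ` B)"
    using vec.dim_le_card[OF sub] fin eq by simp
  then have card: "card (f ` B) = card B"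
    using card_image_le[OF fin, of f] B(4) by simp
  have "vec.independent (f ` B)"
    using B(1) sub fin eq card B(4) by (intro vec.card_le_dim_spanning) auto
  moreover have "inj_on f B" using fin card by (simp add: eq_card_imp_inj_on)
  ultimately have "inj_on f (vec.span B)" by (rule f.inj_on_span_independent_image)
  then show "inj_on f (vec.span V)"
    by (rule inj_on_subset) (simp add: B(3) vec.span_minimal)
next
  assume "inj_on f (vec.span V)"
  with f show "vec.dim (f ` V) = vec.dim V" by (rule vec.dim_image_eq)
qed

text \<open>The inverse of \<open>expand\<close> is linear and injective, and it carries the row
  space of \<open>G\<close> back onto \<open>C\<close>.\<close>

lemma dim_eq_rank_generator_matrix:
  fixes C :: "('a::field^'m^'n) set" and G :: "'a^('n::finite \<times> 'm::finite)^'k"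
  assumes "generator_matrix G C"
  shows "words.dim C = rank G"
proof -
  define unexpand :: "'a^('n \<times> 'm) \<Rightarrow> 'a^'m^'n" where "unexpand v = (\<chi> i j. v $ (i, j))" for v
  interpret unexpand: finite_dimensional_vector_space_pair_1 "(*s)" cart_basis
    "word_scale :: 'a \<Rightarrow> 'a^'m^'n \<Rightarrow> _" ..
  have "Vector_Spaces.linear (*s) word_scale unexpand"
    by unfold_locales (auto simp: unexpand_def word_scale_def vec_eq_iff algebra_simps)
  moreover have "inj_on unexpand X" for X
    by (auto simp: inj_on_def unexpand_def vec_eq_iff)
  ultimately have "words.dim (unexpand ` expand ` C) = vec.dim (expand ` C)"
    by (rule unexpand.dim_image_eq)
  moreover have "unexpand ` expand ` C = C"
    by (simp add: image_image unexpand_def expand_def)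
  moreover have "vec.dim (expand ` C) = rank G"
    using assms unfolding generator_matrix_def row_rank_def_gen by (metis vec.dim_span)
  ultimately show ?thesis by simp
qed

text \<open>Masking preserves the dimension of the row space iff its kernel there is trivial, and
  that kernel consists of the expanded codewords vanishing on \<open>T\<close>.\<close>

lemma rank_thick_restrict_eq_dim_iff:
  fixes C :: "('a::field^'m^'n) set" and G :: "'a^('n::finite \<times> 'm::finite)^'k"
  assumes G: "generator_matrix G C"
  shows "rank (thick_restrict G T) = words.dim C \<longleftrightarrow> determines C T UNIV"
proof -
  have E: "vec.span (rows G) = expand ` C"
    using G by (simp add: generator_matrix_def)
  interpret mask: Vector_Spaces.linear "(*s)" "(*s)" "mask T :: 'a^('n \<times> 'm) \<Rightarrow> _"
    by (rule linear_mask)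
  have "rank (thick_restrict G T) = words.dim C \<longleftrightarrow> inj_on (mask T) (vec.span (rows G))"
    unfolding dim_eq_rank_generator_matrix[OF G] row_rank_def_gen rows_thick_restrict
    by (rule dim_image_eq_iff_inj_on_span) (rule linear_mask)
  also have "\<dots> \<longleftrightarrow> (\<forall>c\<in>C. mask T (expand c) = 0 \<longrightarrow> expand c = 0)"
    unfolding E mask.inj_on_iff_eq_0[OF vec.subspace_span, of "rows G", unfolded E] by simp
  also have "\<dots> \<longleftrightarrow> determines C T UNIV"
    by (auto simp: determines_def mask_def expand_def vec_eq_iff)
  finally show ?thesis .
qed

text \<open>The masked rows lie in the span of the unit vectors at the scalar positions of
  \<open>I\<close>.\<close>

lemma rank_thick_restrict_le:
  fixes G :: "'a::field^('n::finite \<times> 'm::finite)^'k"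
  shows "rank (thick_restrict G I) \<le> card I * CARD('m)"
proof -
  let ?B = "(\<lambda>p. axis p 1 :: 'a^('n \<times> 'm)) ` (I \<times> UNIV)"
  have "v \<in> vec.span ?B" if v: "v \<in> rows (thick_restrict G I)" for v
  proof -
    have "v $ p = 0" if "p \<notin> I \<times> UNIV" for p
      using v that by (cases p) (auto simp: rows_thick_restrict mask_def)
    then have "v = (\<Sum>p\<in>I \<times> UNIV. v $ p *s axis p 1)"
      by (auto simp: vec_eq_iff axis_def if_distrib cong: if_cong)
    also have "\<dots> \<in> vec.span ?B"
      by (intro vec.span_sum vec.span_scale vec.span_base) auto
    finally show ?thesis .
  qed
  then have "rank (thick_restrict G I) \<le> card ?B"
    unfolding row_rank_def_gen by (intro vec.dim_le_card) auto
  also have "\<dots> \<le> card I * CARD('m)"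
    using card_image_le[of "I \<times> (UNIV :: 'm set)"] by (simp add: card_cartesian_product)
  finally show ?thesis .
qed

section \<open>Information sets and quasi-dimension\<close>

text \<open>A subset of \<open>J\<close> that is minimal among those with the rank of
  \<open>T\<close> is an information set, since minimality compares it only with its own
  subsets.\<close>

lemma information_set_subset_exists:
  fixes G :: "'a::field^('n::finite \<times> 'm::finite)^'k"
  assumes "J \<subseteq> T" and "rank (thick_restrict G J) = rank (thick_restrict G T)"
  obtains I where "information_set G T I" and "I \<subseteq> J"
proof -
  define Q where "Q = {I. I \<subseteq> J \<and> rank (thick_restrict G I) = rank (thick_restrict G T)}"
  have "finite Q" "Q \<noteq> {}" using assms(2) by (auto simp: Q_def)
  then obtain I where "I \<in> Q" "\<And>I'. I' \<in> Q \<Longrightarrow> I' \<subseteq> I \<Longrightarrow> I = I'"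
    by (rule finite_has_minimal[elim_format]) blast
  then show thesis
    using assms(1) by (intro that[of I]) (auto simp: information_set_def Q_def)
qed

text \<open>Shrinking \<open>J\<close> to an information set extends the lower bound on cardinality
  to all sets with the rank of \<open>T\<close>, minimal or not.\<close>

lemma quasi_dimension_le:
  fixes G :: "'a::field^('n::finite \<times> 'm::finite)^'k"
  assumes "J \<subseteq> T" and "rank (thick_restrict G J) = rank (thick_restrict G T)"
  shows "quasi_dimension G T \<le> card J"
proof -
  obtain I where "information_set G T I" "I \<subseteq> J"
    using assms by (rule information_set_subset_exists)
  then have "quasi_dimension G T \<le> card I" "card I \<le> card J"
    unfolding quasi_dimension_def by (auto intro: Min_le card_mono)
  then show ?thesis by simp
qed

text \<open>\<open>T\<close> contains an information set, so \<open>Min\<close> ranges over a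
  nonempty finite set.\<close>

lemma quasi_dimension_attained:
  fixes G :: "'a::field^('n::finite \<times> 'm::finite)^'k"
  obtains I where "information_set G T I" and "card I = quasi_dimension G T"
proof -
  obtain I where "information_set G T I"
    using information_set_subset_exists[OF subset_refl refl] by blast
  then have "quasi_dimension G T \<in> card ` {I. information_set G T I}"
    unfolding quasi_dimension_def by (intro Min_in) auto
  then show thesis using that by auto
qed

section \<open>The chain of bounds on the minimum distance\<close>

theorem mainTheorem14:
  fixes C :: "('a::{field,finite}^'m^'n) set"
    and G :: "'a^('n::finite \<times> 'm::finite)^'k"
    and n K d\<^sub>m\<^sub>i\<^sub>n \<alpha> \<kappa> r \<delta> :: nat
    and L :: "'l set"
    and S :: "'l \<Rightarrow> 'n set"
    and I\<^sub>0 :: "'n set"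
  assumes "words.subspace C"
    and "generator_matrix G C"
    and "thick_columns_independent G"
    and "CARD('n) = n"
    and "words.dim C = K"
    and "min_dist C = enat d\<^sub>m\<^sub>i\<^sub>n"
    and "CARD('m) = \<alpha>"
    and "quasi_dimension G UNIV = \<kappa>"
    and "\<delta> \<ge> 2"
    and "local_codes G C r \<delta> L S"
    and "information_set G (\<Union>i\<in>L. S i) I\<^sub>0"
    and "card I\<^sub>0 = quasi_dimension G (\<Union>i\<in>L. S i)"
  shows "int d\<^sub>m\<^sub>i\<^sub>n \<le> int n - int (card I\<^sub>0) + 1
             - (\<lceil>real (card I\<^sub>0) / real r\<rceil> - 1) * (int \<delta> - 1) \<and>
         int n - int (card I\<^sub>0) + 1 - (\<lceil>real (card I\<^sub>0) / real r\<rceil> - 1) * (int \<delta> - 1)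
           \<le> int n - int \<kappa> + 1 - (\<lceil>real \<kappa> / real r\<rceil> - 1) * (int \<delta> - 1) \<and>
         int n - int \<kappa> + 1 - (\<lceil>real \<kappa> / real r\<rceil> - 1) * (int \<delta> - 1)
           \<le> int n - \<lceil>real K / real \<alpha>\<rceil> + 1
             - (\<lceil>real K / (real r * real \<alpha>)\<rceil> - 1) * (int \<delta> - 1)"
proof -
  let ?S = "\<Union>i\<in>L. S i"
  have rank_eq: "rank (thick_restrict G T) = K \<longleftrightarrow> determines C T UNIV" for T
    using rank_thick_restrict_eq_dim_iff[OF assms(2)] assms(5) by simp
  have rank_UNIV: "rank (thick_restrict G UNIV) = K"
    by (simp add: rank_eq determines_superset)
  have rank_S: "rank (thick_restrict G ?S) = K"
    and local: "\<And>i. i \<in> L \<Longrightarrow> card (S i) \<le> r + \<delta> - 1"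
      "\<And>i. i \<in> L \<Longrightarrow> enat \<delta> \<le> min_dist (puncture (S i) C)"
    using assms(5,10) by (auto simp: local_codes_def)
  \<comment> \<open>A finite minimum distance excludes the zero code, so the greedy construction can
    start at the empty set.\<close>
  have nonzero: "\<not> determines C {} UNIV"
  proof
    assume "determines C {} UNIV"
    then have "C - {0} = {}" by (auto simp: determines_def vec_eq_iff)
    then have "min_dist C = \<infinity>" unfolding min_dist_def by (simp only: image_empty Inf_empty top_enat_def)
    then show False using assms(6) by simp
  qed
  obtain T j where T: "\<not> determines C T UNIV" "card I\<^sub>0 + j * (\<delta> - 1) \<le> card T + 1"
    and j: "card I\<^sub>0 \<le> Suc j * r"
  proof (rule greedy_non_determining_set[where C = C and L = L and S = S and r = r and \<delta> = \<delta>
        and m = "card I\<^sub>0"])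
    show "determines C (S i - D) (S i)" if "i \<in> L" "card D < \<delta>" for i D
      using local(2)[OF that(1)] that(2) by (rule determines_Diff_if_puncture_min_dist)
    show "determines C ?S UNIV" using rank_S rank_eq by simp
    \<comment> \<open>The minimum cardinality of \<open>I\<^sub>0\<close> enters here: full rank on
      \<open>A\<close> is the rank on \<open>?S\<close>.\<close>
    show "card I\<^sub>0 \<le> card A" if "A \<subseteq> ?S" "determines C A UNIV" for A
      using quasi_dimension_le[OF that(1), of G] that(2) rank_S rank_eq assms(12) by simp
  qed (use local nonzero assms(9) in auto)
  have "d\<^sub>m\<^sub>i\<^sub>n \<le> n - card T"
    using min_dist_le_if_not_determines[OF T(1)] assms(4,6) by simp
  moreover have "card T \<le> n"
    using card_mono[of UNIV T] assms(4) by simp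
  ultimately have d: "int d\<^sub>m\<^sub>i\<^sub>n \<le> int n - int (card T)" by linarith
  have "real (card I\<^sub>0) / real r \<le> real (Suc j)"
  \<comment> \<open>For r = 0 the quotient is 0 by the convention on division.\<close>
  proof (cases "r = 0")
    case False
    moreover have "real (card I\<^sub>0) \<le> real (Suc j) * real r"
      using j by (simp only: of_nat_le_iff flip: of_nat_mult)
    ultimately show ?thesis by (simp add: divide_le_eq)
  qed simp
  then have "\<lceil>real (card I\<^sub>0) / real r\<rceil> \<le> int (Suc j)"
    by (simp only: ceiling_le_iff of_int_of_nat_eq)
  then have "\<lceil>real (card I\<^sub>0) / real r\<rceil> - 1 \<le> int j" by simp
  then have "(\<lceil>real (card I\<^sub>0) / real r\<rceil> - 1) * (int \<delta> - 1) \<le> int j * (int \<delta> - 1)"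
    using assms(9) by (intro mult_right_mono) auto
  moreover have "int (card I\<^sub>0) + int j * (int \<delta> - 1) \<le> int (card T) + 1"
  proof -
    have "int (card I\<^sub>0 + j * (\<delta> - 1)) \<le> int (card T + 1)"
      using T(2) by (simp only: of_nat_le_iff)
    then show ?thesis using assms(9) by (simp add: of_nat_diff)
  qed
  ultimately have first: "int d\<^sub>m\<^sub>i\<^sub>n \<le> int n - int (card I\<^sub>0) + 1
      - (\<lceil>real (card I\<^sub>0) / real r\<rceil> - 1) * (int \<delta> - 1)"
    using d by linarith

  \<comment> \<open>\<open>I\<^sub>0\<close> has rank \<open>K\<close>, since the union of the
    supports does. The bound is antitone in the cardinality, so passing to \<kappa> weakens
    it.\<close>
  have \<kappa>: "\<kappa> \<le> card I\<^sub>0"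
    using quasi_dimension_le[of I\<^sub>0 UNIV G] assms(8,11) rank_S rank_UNIV
    by (simp add: information_set_def)
  then have "\<lceil>real \<kappa> / real r\<rceil> \<le> \<lceil>real (card I\<^sub>0) / real r\<rceil>"
    by (intro ceiling_mono divide_right_mono) auto
  then have "(\<lceil>real \<kappa> / real r\<rceil> - 1) * (int \<delta> - 1)
      \<le> (\<lceil>real (card I\<^sub>0) / real r\<rceil> - 1) * (int \<delta> - 1)"
    using assms(9) by (intro mult_right_mono) auto
  note second = this \<kappa>

  \<comment> \<open>An information set of \<kappa> thick columns has rank at most \<kappa> \<alpha>.
    Hence K/\<alpha> is at most \<kappa>, and antitonicity gives the last bound.\<close>
  obtain I where "information_set G UNIV I" "card I = \<kappa>"
    using quasi_dimension_attained[of G UNIV] assms(8) by metis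
  then have "K \<le> \<kappa> * \<alpha>"
    using rank_thick_restrict_le[of G I] rank_UNIV assms(7) by (simp add: information_set_def)
  moreover have "\<alpha> > 0" using assms(7) by auto
  ultimately have K: "real K / real \<alpha> \<le> real \<kappa>"
    by (simp add: divide_le_eq flip: of_nat_mult)
  then have "(real K / real \<alpha>) / real r \<le> real \<kappa> / real r"
    by (intro divide_right_mono) auto
  then have "\<lceil>real K / (real r * real \<alpha>)\<rceil> \<le> \<lceil>real \<kappa> / real r\<rceil>"
    by (intro ceiling_mono) (simp add: mult.commute)
  then have "(\<lceil>real K / (real r * real \<alpha>)\<rceil> - 1) * (int \<delta> - 1)
      \<le> (\<lceil>real \<kappa> / real r\<rceil> - 1) * (int \<delta> - 1)"
    using assms(9) by (intro mult_right_mono) auto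
  moreover have "\<lceil>real K / real \<alpha>\<rceil> \<le> int \<kappa>" using K by (simp add: ceiling_le_iff)
  ultimately show ?thesis using first second by linarith
qed

end
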